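(* Let $\beta\in(0,\infty)$, $\sigma\in\mathbb{R}$ and suppose $\gamma>0$. For all $N\in\{3,4,\dots\}$ and $j\in\{0,1,\dots,N-1\}$ let $$v_j^N=\frac{\sigma^2}{2N}\sum_{k=0}^{N-1}\frac{\cos(2\pi jk/N)}{\gamma+4\beta\sin^2(\pi k/N)}.$$ Then for all $\tilde N\in\{3,4,\dots\}$ and $j\in\{0,1,\dots,\tilde N-1\}$ the sequence $(v_j^N)_{N\in\{\tilde N,\tilde N+1,\dots\}}$ converges (as $N\to\infty$) to $\dfrac{\sigma^2a^j}{2F}$, where $$a=1+\frac{\gamma}{2\beta}-\frac{F}{2\beta}\qquad\text{and}\qquad F=\sqrt{\gamma^2+4\beta\gamma}.$$
   Context: All parameters $\beta,\gamma,\sigma$ are fixed real numbers independent of $N$. (The numbers $v_0^N,\dots,v_{N-1}^N$ are the entries of the first column of the circulant velocity block of the stationary covariance matrix of a linear stochastic $N$-agent system; this interpretation is not needed for the claim.) *)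

theory Defs
  imports Complex_Main
begin

definition vel_cov :: "real \<Rightarrow> real \<Rightarrow> real \<Rightarrow> nat \<Rightarrow> nat \<Rightarrow> real" where
  "vel_cov \<beta> \<gamma> \<sigma> N j =
    \<sigma>\<^sup>2 / (2 * real N) *
      (\<Sum>k = 0..<N. cos (2 * pi * real j * real k / real N)
                    / (\<gamma> + 4 * \<beta> * (sin (pi * real k / real N))\<^sup>2))"

definition limit_F :: "real \<Rightarrow> real \<Rightarrow> real" where
  "limit_F \<beta> \<gamma> = sqrt (\<gamma>\<^sup>2 + 4 * \<beta> * \<gamma>)"

definition limit_a :: "real \<Rightarrow> real \<Rightarrow> real" where
  "limit_a \<beta> \<gamma> = 1 + \<gamma> / (2 * \<beta>) - limit_F \<beta> \<gamma> / (2 * \<beta>)"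

end

theory Submission
  imports Defs
begin

text \<open>
  With \<open>\<theta> = 2\<pi>k/N\<close> the denominator \<open>\<gamma> + 4\<beta> sin\<^sup>2(\<theta>/2)\<close> factors as \<open>(\<beta>/a)(1 - 2a cos \<theta> + a\<^sup>2)\<close>,
  where \<open>a\<close> is the root in \<open>(0,1)\<close> of \<open>\<beta>(1 + a\<^sup>2) = (\<gamma> + 2\<beta>)a\<close>. Its reciprocal is therefore a multiple of
  the Poisson kernel, which at an \<open>N\<close>-th root of unity is a finite Fourier sum with
  coefficients proportional to \<open>a\<^sup>m + a\<^bsup>N-m\<^esup>\<close>. Orthogonality of the characters of the cyclic group of
  order \<open>N\<close> then gives \<open>v\<^sub>j = (\<sigma>\<^sup>2/2F)(a\<^sup>j + a\<^bsup>N-j\<^esup>)/(1 - a\<^sup>N)\<close>, from which the limit is immediate.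
\<close>

text \<open>The summands are powers of one \<open>N\<close>-th root of unity \<open>z\<close>, so
  the geometric sum vanishes unless \<open>z = 1\<close>. Since \<open>j\<close> and
  \<open>m\<close> differ by less than \<open>N\<close>, that happens only for
  \<open>m = j\<close>.\<close>

lemma sum_cis_orthogonal:
  fixes N j m :: nat
  assumes "j < N" "m < N"
  shows "(\<Sum>k<N. cis (2 * pi * real j * real k / real N) * cis (- (2 * pi * real k / real N)) ^ m)
           = (if m = j then of_nat N else 0)"
proof -
  define z where "z = cis (2 * pi * (real j - real m) / real N)"
  have "cis (2 * pi * real j * real k / real N) * cis (- (2 * pi * real k / real N)) ^ m = z ^ k" for k
    by (simp add: z_def DeMoivre cis_mult algebra_simps diff_divide_distrib)
  hence sum_eq: "(\<Sum>k<N. cis (2 * pi * real j * real k / real N) * cis (- (2 * pi * real k / real N)) ^ m)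
      = (\<Sum>k<N. z ^ k)"
    by simp
  show ?thesis
  proof (cases "m = j")
    case True
    then show ?thesis using sum_eq by (simp add: z_def)
  next
    case False
    have zN: "z ^ N = 1"
    proof -
      have "z ^ N = cis (2 * pi * of_int (int j - int m))"
        using assms by (simp add: z_def DeMoivre)
      also have "\<dots> = 1"
        by (intro cis_multiple_2pi) simp
      finally show ?thesis .
    qed
    have "z \<noteq> 1"
    proof
      assume "z = 1"
      hence "cos (2 * pi * (real j - real m) / real N) = 1"
        by (simp add: z_def complex_eq_iff)
      then obtain n :: int where "2 * pi * (real j - real m) / real N = of_int n * 2 * pi"
        unfolding cos_one_2pi_int by blast
      hence "2 * pi * (real j - real m) = 2 * pi * (of_int n * real N)"
        using assms by (simp add: divide_eq_eq)
      hence "real j - real m = of_int n * real N"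
        by simp
      hence "of_int (int j - int m) = (of_int (n * int N) :: real)"
        by simp
      hence "int j - int m = n * int N"
        by (simp only: of_int_eq_iff)
      hence "int N dvd int j - int m" by simp
      moreover have "\<bar>int j - int m\<bar> < int N" using assms by linarith
      ultimately have "int j - int m = 0"
        using dvd_imp_le_int[of "int j - int m" "int N"] by linarith
      thus False using False by simp
    qed
    hence "(\<Sum>k<N. z ^ k) = 0"
      using zN by (simp add: sum_gp_strict)
    then show ?thesis using sum_eq False by simp
  qed
qed

text \<open>Both halves are geometric sums closed up by \<open>w ^ N = 1\<close>: one telescopes
  against \<open>1 - a * w\<close>, the other against \<open>w - a\<close>. For real
  \<open>a\<close> and \<open>w\<close> on the unit circle, the product of these factors is
  \<open>w\<close> times the squared modulus of \<open>1 - a * w\<close>.\<close>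

lemma finite_poisson_kernel:
  fixes a w :: "'a :: comm_ring_1"
  assumes "w ^ N = 1"
  shows "(\<Sum>m<N. (a ^ m + a ^ (N - m)) * w ^ m) * ((1 - a * w) * (w - a))
           = (1 - a ^ N) * (1 - a\<^sup>2) * w"
proof -
  have A: "(\<Sum>m<N. a ^ m * w ^ m) * (1 - a * w) = 1 - a ^ N"
    using one_diff_power_eq[of "a * w" N] assms
    by (simp add: power_mult_distrib mult.commute)
  \<comment> \<open>Splitting off one factor \<open>a\<close> leaves the exponents of the standard
    factorization of \<open>w ^ N - a ^ N\<close>.\<close>
  have "a ^ (N - m) = a * a ^ (N - Suc m)" if "m < N" for m
    using that by (metis Suc_diff_Suc power_Suc)
  hence "(\<Sum>m<N. a ^ (N - m) * w ^ m) = a * (\<Sum>m<N. a ^ (N - Suc m) * w ^ m)"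
    unfolding sum_distrib_left by (intro sum.cong) (simp_all only: lessThan_iff mult.assoc)
  hence B: "(\<Sum>m<N. a ^ (N - m) * w ^ m) * (w - a) = a * (1 - a ^ N)"
    using power_diff_sumr2[of w N a] assms by (simp add: mult.assoc mult.left_commute mult.commute)
  have "(\<Sum>m<N. (a ^ m + a ^ (N - m)) * w ^ m) * ((1 - a * w) * (w - a))
      = ((\<Sum>m<N. a ^ m * w ^ m) * (1 - a * w)) * (w - a)
        + ((\<Sum>m<N. a ^ (N - m) * w ^ m) * (w - a)) * (1 - a * w)"
    by (simp add: sum.distrib algebra_simps)
  also have "\<dots> = (1 - a ^ N) * (1 - a\<^sup>2) * w"
    unfolding A B by (simp add: algebra_simps power2_eq_square)
  finally show ?thesis .
qed

lemma limit_a_properties: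
  fixes \<beta> \<gamma> :: real
  assumes "\<beta> > 0" "\<gamma> > 0"
  defines "a \<equiv> limit_a \<beta> \<gamma>" and "F \<equiv> limit_F \<beta> \<gamma>"
  shows "0 < a" "a < 1" "0 < F" "\<beta> * (1 + a\<^sup>2) = (\<gamma> + 2 * \<beta>) * a" "F * a = \<beta> * (1 - a\<^sup>2)"
proof -
  have F2: "F\<^sup>2 = \<gamma>\<^sup>2 + 4 * \<beta> * \<gamma>"
    using assms by (simp add: F_def limit_F_def)
  show F0: "0 < F"
    using assms by (simp add: F_def limit_F_def add_pos_pos)
  \<comment> \<open>\<open>F\<^sup>2\<close> exceeds \<open>\<gamma>\<^sup>2\<close> by
    \<open>4 * \<beta> * \<gamma>\<close> and falls short of
    \<open>(\<gamma> + 2 * \<beta>)\<^sup>2\<close> by \<open>4 * \<beta>\<^sup>2\<close>. The lower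
    bound on \<open>F\<close> yields \<open>a < 1\<close>, the upper one
    \<open>0 < a\<close>.\<close>
  have "\<gamma> < F"
    by (rule power2_less_imp_less) (use F0 F2 assms in auto)
  moreover have "F < \<gamma> + 2 * \<beta>"
    by (rule power2_less_imp_less)
      (use F2 assms in \<open>auto simp: power2_sum power_mult_distrib mult_ac\<close>)
  moreover have a: "2 * \<beta> * a = 2 * \<beta> + \<gamma> - F"
    using assms by (simp add: a_def F_def limit_a_def field_simps)
  ultimately have "0 < 2 * \<beta> * a" "2 * \<beta> * a < 2 * \<beta> * 1" by linarith+
  with assms(1) show "0 < a" "a < 1"
    using zero_less_mult_pos[of "2 * \<beta>" a] mult_less_cancel_left_pos[of "2 * \<beta>" a 1] by simp_all
  have F: "F = 2 * \<beta> + \<gamma> - 2 * \<beta> * a" using a by simp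
  \<comment> \<open>Squaring the linear relation between \<open>F\<close> and \<open>a\<close> and
    comparing with \<open>F2\<close> gives the quadratic equation times
    \<open>4 * \<beta>\<close>.\<close>
  have "4 * \<beta> * (\<beta> * (1 + a\<^sup>2)) = 4 * \<beta> * ((\<gamma> + 2 * \<beta>) * a)"
    using F2 unfolding F by algebra
  then show quad: "\<beta> * (1 + a\<^sup>2) = (\<gamma> + 2 * \<beta>) * a"
    using assms(1) by simp
  show "F * a = \<beta> * (1 - a\<^sup>2)"
    using quad unfolding F by algebra
qed

lemma reciprocal_eq_poisson_sum:
  fixes \<beta> \<gamma> :: real and N k :: nat
  assumes "\<beta> > 0" "\<gamma> > 0" "N > 0"
  defines "a \<equiv> limit_a \<beta> \<gamma>" and "F \<equiv> limit_F \<beta> \<gamma>"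
  shows "complex_of_real (F * (1 - a ^ N) / (\<gamma> + 4 * \<beta> * (sin (pi * real k / real N))\<^sup>2))
    = (\<Sum>m<N. of_real (a ^ m + a ^ (N - m)) * cis (- (2 * pi * real k / real N)) ^ m)"
proof -
  note a = limit_a_properties[OF assms(1,2), folded a_def F_def]
  define t where "t = 2 * pi * real k / real N"
  define D where "D = \<gamma> + 4 * \<beta> * (sin (pi * real k / real N))\<^sup>2"
  define S where "S = (\<Sum>m<N. of_real (a ^ m + a ^ (N - m)) * cis (- t) ^ m)"
  have "D > 0"
    unfolding D_def using assms(1,2) by (intro add_pos_nonneg) auto
  have "cos t = 1 - 2 * (sin (pi * real k / real N))\<^sup>2"
    using cos_double_sin[of "pi * real k / real N"] by (simp add: t_def mult_ac)
  hence D_eq: "D = \<gamma> + 2 * \<beta> - 2 * \<beta> * cos t"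
    by (simp add: D_def right_diff_distrib)
  have aD: "a * D = \<beta> * (1 + a\<^sup>2 - 2 * a * cos t)"
    using a(4) unfolding D_eq by (simp add: algebra_simps)
  have "cis (- t) ^ N = cis (2 * pi * of_int (- int k))"
    using assms(3) by (simp add: DeMoivre t_def)
  also have "\<dots> = 1"
    by (intro cis_multiple_2pi) simp
  finally have "cis (- t) ^ N = 1" .
  from finite_poisson_kernel[OF this, of "complex_of_real a"]
  have "S * ((1 - of_real a * cis (- t)) * (cis (- t) - of_real a))
      = (1 - of_real a ^ N) * (1 - (of_real a)\<^sup>2) * cis (- t)"
    by (simp add: S_def)
  \<comment> \<open>Pulling out \<open>cis (- t)\<close> leaves the real Poisson denominator; the
    same nonzero factor stands on the right of the kernel identity and cancels.\<close>
  moreover have "(1 - of_real a * cis (- t)) * (cis (- t) - of_real a)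
      = of_real (1 + a\<^sup>2 - 2 * a * cos t) * cis (- t)"
  proof -
    have "cis t * cis (- t) = 1" by (simp add: cis_mult)
    moreover have "complex_of_real (1 + a\<^sup>2 - 2 * a * cos t)
        = 1 + (of_real a)\<^sup>2 - of_real a * (cis t + cis (- t))"
      by (simp add: complex_eq_iff power2_eq_square)
    ultimately show ?thesis by algebra
  qed
  ultimately have "S * of_real (1 + a\<^sup>2 - 2 * a * cos t) = of_real ((1 - a ^ N) * (1 - a\<^sup>2))"
    by simp
  \<comment> \<open>The factor \<beta> turns the two sides into multiples of \<open>a * D\<close>
    and \<open>F * a\<close>, after which \<open>a > 0\<close> cancels.\<close>
  hence "S * of_real (\<beta> * (1 + a\<^sup>2 - 2 * a * cos t)) = of_real ((1 - a ^ N) * (\<beta> * (1 - a\<^sup>2)))"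
    by (simp add: mult_ac)
  hence "S * of_real D = of_real (F * (1 - a ^ N))"
    using a(1) unfolding aD[symmetric] a(5)[symmetric] by (simp add: mult_ac)
  hence "of_real (F * (1 - a ^ N) / D) = S"
    using \<open>D > 0\<close> unfolding of_real_divide by (simp add: divide_eq_eq)
  thus ?thesis
    unfolding S_def D_def t_def .
qed

lemma vel_cov_closed_form:
  fixes \<beta> \<gamma> \<sigma> :: real and N j :: nat
  assumes "\<beta> > 0" "\<gamma> > 0" "j < N"
  defines "a \<equiv> limit_a \<beta> \<gamma>" and "F \<equiv> limit_F \<beta> \<gamma>"
  shows "vel_cov \<beta> \<gamma> \<sigma> N j = \<sigma>\<^sup>2 * (a ^ j + a ^ (N - j)) / (2 * F * (1 - a ^ N))"
proof -
  note a = limit_a_properties[OF assms(1,2), folded a_def F_def]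
  have "N > 0" using assms(3) by simp
  define D where "D k = \<gamma> + 4 * \<beta> * (sin (pi * real k / real N))\<^sup>2" for k
  define x where "x k = 2 * pi * real j * real k / real N" for k
  define w where "w k = cis (- (2 * pi * real k / real N))" for k
  define c where "c m = a ^ m + a ^ (N - m)" for m
  have "a ^ N < 1"
    using a(1,2) \<open>N > 0\<close> by (simp add: power_less_one_iff)
  \<comment> \<open>The cosine is replaced by \<open>cis\<close> to make orthogonality applicable;
    as the weights are real, taking real parts later recovers the cosine sum.\<close>
  have "(\<Sum>k<N. cis (x k) * of_real (F * (1 - a ^ N) / D k))
      = (\<Sum>k<N. \<Sum>m<N. of_real (c m) * (cis (x k) * w k ^ m))"
    unfolding D_def a_def F_def reciprocal_eq_poisson_sum[OF assms(1,2) \<open>N > 0\<close>]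
    by (simp add: c_def w_def a_def sum_distrib_left mult_ac)
  also have "\<dots> = (\<Sum>m<N. of_real (c m) * (\<Sum>k<N. cis (x k) * w k ^ m))"
    by (subst sum.swap) (simp add: sum_distrib_left)
  also have "\<dots> = (\<Sum>m<N. of_real (c m) * (if m = j then of_nat N else 0))"
    using assms(3) by (simp add: x_def w_def sum_cis_orthogonal)
  also have "\<dots> = of_real (real N * c j)"
    using assms(3) by (simp add: if_distrib cong: if_cong)
  finally have "Re (\<Sum>k<N. cis (x k) * of_real (F * (1 - a ^ N) / D k)) = real N * c j"
    by (simp only: Re_complex_of_real)
  hence "F * (1 - a ^ N) * (\<Sum>k<N. cos (x k) / D k) = real N * c j"
    by (simp add: sum_distrib_left mult_ac del: of_real_divide of_real_mult of_real_diff of_real_power)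
  hence "(\<Sum>k<N. cos (x k) / D k) = real N * c j / (F * (1 - a ^ N))"
    using a(3) \<open>a ^ N < 1\<close> by (simp add: field_simps)
  thus ?thesis
    using \<open>N > 0\<close> by (simp add: vel_cov_def x_def D_def c_def atLeast0LessThan)
qed

theorem corollary11:
  fixes \<beta> \<gamma> \<sigma> :: real and N0 j :: nat
  assumes "\<beta> > 0" and "\<gamma> > 0"
    and "N0 \<ge> 3" and "j \<in> {0..N0 - 1}"
  shows "(\<lambda>n. vel_cov \<beta> \<gamma> \<sigma> (N0 + n) j)
           \<longlonglongrightarrow> \<sigma>\<^sup>2 * limit_a \<beta> \<gamma> ^ j / (2 * limit_F \<beta> \<gamma>)"
proof -
  define a where "a = limit_a \<beta> \<gamma>"
  define F where "F = limit_F \<beta> \<gamma>"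
  note a = limit_a_properties[OF assms(1,2), folded a_def F_def]
  have "j < N0" using assms(3,4) by auto
  have an: "(\<lambda>n. a ^ n) \<longlonglongrightarrow> 0"
    using a(1,2) by (intro LIMSEQ_realpow_zero) auto
  \<comment> \<open>The closed form at \<open>N0 + n\<close>, with \<open>a ^ n\<close> isolated;
    \<open>j < N0\<close> makes \<open>N0 + n - j\<close> equal to \<open>(N0 - j) + n\<close>
    despite truncated subtraction.\<close>
  have "(\<lambda>n. \<sigma>\<^sup>2 * (a ^ j + a ^ (N0 - j) * a ^ n) / (2 * F * (1 - a ^ N0 * a ^ n)))
      \<longlonglongrightarrow> \<sigma>\<^sup>2 * (a ^ j + a ^ (N0 - j) * 0) / (2 * F * (1 - a ^ N0 * 0))"
    using a(3) by (intro tendsto_intros an) auto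
  moreover have "vel_cov \<beta> \<gamma> \<sigma> (N0 + n) j
      = \<sigma>\<^sup>2 * (a ^ j + a ^ (N0 - j) * a ^ n) / (2 * F * (1 - a ^ N0 * a ^ n))" for n
    using vel_cov_closed_form[OF assms(1,2), of j "N0 + n" \<sigma>] \<open>j < N0\<close>
    by (simp add: a_def F_def flip: power_add)
  ultimately show ?thesis
    by (simp add: a_def F_def)
qed

end
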